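(* Let $k_i, m_i\in\mathbb{N}$, $1\le i\le n$. If $$0^{k_1}1^{m_1}\cdots 0^{k_n}1^{m_n}(\alpha)=1,$$ then there exists $\alpha\in\mathbb{N}$ (satisfying this equation). In particular, the set $$\{\alpha \;:\; k_n=2l_n\cdot 3^{m_n-1},\ k_{n-1}=2l_{n-1}\cdot 3^{m_{n-1}+m_n-1},\ \ldots,\ k_2=2l_2\cdot 3^{m_2+\cdots+m_n-1}\ \text{and}\ k_1=(2l_1-1)\cdot 3^{m_1+\cdots+m_n-1},\ \ l_i,m_i\in\mathbb{N},\ 1\le i\le n\}$$ of those $\alpha$ determined by the equation for such exponents is a subset of the set of solutions $\alpha\in\mathbb{N}$.
   Context: $\mathbb{N}=\{1,2,3,\ldots\}$ and $n\in\mathbb{N}$. The symbols $0$ and $1$, when used as letters in a word applied to a number, denote the relations $0:x\mapsto \frac{x}{2}$ and $1:x\mapsto\frac{3x+1}{2}$. Words denote compositions read from right to left (the rightmost letter is applied first), and $s^k$ denotes the $k$-fold composition of $s$ with itself; thus in $0^{k_1}1^{m_1}\cdots 0^{k_n}1^{m_n}(\alpha)$ one first applies $1$ exactly $m_n$ times to $\alpha$, then $0$ exactly $k_n$ times, and so on, ending with $k_1$ applications of $0$. For given exponents $k_i,m_i$, the equation $0^{k_1}1^{m_1}\cdots 0^{k_n}1^{m_n}(\alpha)=1$, with the letters read as these formulas on rational numbers, determines $\alpha$ uniquely as a rational number, obtained by inverting the letters successively starting from $1$; a solution is such an $\alpha$ that lies in $\mathbb{N}$.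
   Formalization: The first sentence fails for arbitrary k_i, m_i (n=1, k_1=2, m_1=1 gives α=7/3); it is read as: for every n and all m_1,…,m_n in N there exist k_1,…,k_n in N and α in N satisfying the equation. *)

theory Defs
  imports Complex_Main
begin

definition letter0 :: "rat \<Rightarrow> rat" where
  "letter0 x = x / 2"

definition letter1 :: "rat \<Rightarrow> rat" where
  "letter1 x = (3 * x + 1) / 2"

text \<open>The word \<open>0^{k 1} 1^{m 1} ... 0^{k n} 1^{m n}\<close>, read from right to left: the block
  with the largest index is applied first. Only the values of \<open>k\<close> and \<open>m\<close> on
  \<open>{1..n}\<close> matter.\<close>

primrec word :: "nat \<Rightarrow> (nat \<Rightarrow> nat) \<Rightarrow> (nat \<Rightarrow> nat) \<Rightarrow> rat \<Rightarrow> rat" where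
  "word 0 k m = id"
| "word (Suc n) k m = word n k m \<circ> (letter0 ^^ k (Suc n)) \<circ> (letter1 ^^ m (Suc n))"

definition positive_upto :: "nat \<Rightarrow> (nat \<Rightarrow> nat) \<Rightarrow> bool" where
  "positive_upto n f \<longleftrightarrow> (\<forall>i\<in>{1..n}. 1 \<le> f i)"

text \<open>The natural numbers start at 1 here. Only \<open>\<alpha>\<close> is required to be a natural number:
  the intermediate values of the word are rationals without any parity restriction.\<close>

definition solutions :: "nat \<Rightarrow> (nat \<Rightarrow> nat) \<Rightarrow> (nat \<Rightarrow> nat) \<Rightarrow> rat set" where
  "solutions n k m = {\<alpha>. \<alpha> \<in> of_nat ` {1..} \<and> word n k m \<alpha> = 1}"

definition all_solutions :: "nat \<Rightarrow> rat set" where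
  "all_solutions n = (\<Union>(k, m) \<in> {(k, m). positive_upto n k \<and> positive_upto n m}. solutions n k m)"

text \<open>The natural number subtractions below are not truncated, since all \<open>l i\<close> and
  \<open>m i\<close> are positive wherever the definition is used. For \<open>n = 1\<close> only the
  formula for \<open>k 1\<close> applies.\<close>

definition special_exponents :: "nat \<Rightarrow> (nat \<Rightarrow> nat) \<Rightarrow> (nat \<Rightarrow> nat) \<Rightarrow> (nat \<Rightarrow> nat) \<Rightarrow> bool" where
  "special_exponents n l m k \<longleftrightarrow>
     k 1 = (2 * l 1 - 1) * 3 ^ ((\<Sum>j=1..n. m j) - 1) \<and>
     (\<forall>i\<in>{2..n}. k i = 2 * l i * 3 ^ ((\<Sum>j=i..n. m j) - 1))"

text \<open>Here \<open>\<alpha>\<close> is an arbitrary rational; that it is a natural number is a claim.\<close>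

definition special_set :: "nat \<Rightarrow> rat set" where
  "special_set n = {\<alpha>. \<exists>k l m. positive_upto n l \<and> positive_upto n m \<and>
     special_exponents n l m k \<and> word n k m \<alpha> = 1}"

end

theory Submission
  imports Defs "HOL-Number_Theory.Cong"
begin

text \<open>
  Invert the blocks one after the other, starting from \<open>1\<close>. Conjugation by the fixed point
  \<open>-1\<close> of letter \<open>1\<close> gives \<open>1\<^sup>m(\<alpha>) + 1 = (3/2)\<^sup>m (\<alpha> + 1)\<close>, so that inverting
  \<open>0\<^sup>k 1\<^sup>m\<close> at \<open>x\<close> stays in the natural numbers as soon as \<open>3\<^sup>m\<close> divides \<open>2\<^sup>k x + 1\<close>.
  Let \<open>M i = m i + ... + m n\<close>. Because \<open>(-2)^(3\<^sup>s)\<close> is \<open>1\<close> modulo \<open>3\<^sup>s\<^sup>+\<^sup>1\<close>, the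
  special choice of \<open>k 1\<close> makes \<open>2^(k 1) + 1\<close> divisible by \<open>3^(M 1)\<close>, and for \<open>i \<ge> 2\<close>
  the special choice of \<open>k i\<close> makes \<open>2^(k i)\<close> congruent to \<open>1\<close> modulo \<open>3^(M i)\<close>. Hence
  the value \<open>x\<close> obtained after \<open>i\<close> inversions is a natural number with \<open>x = -1\<close> modulo
  \<open>3^(M (i + 1))\<close>, and the next inversion is possible again.
\<close>

lemma letter0_pow: "(letter0 ^^ k) x = x / 2 ^ k"
  by (induction k) (auto simp: letter0_def)

lemma letter1_pow: "(letter1 ^^ m) x = (3 / 2) ^ m * (x + 1) - 1"
  by (induction m) (auto simp: letter1_def field_simps)

text \<open>Each letter is an injective affine map. This identifies a given rational solution with
  the natural number constructed by inversion.\<close>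

lemma inj_word: "inj (word n k m)"
proof (induction n)
  case (Suc n)
  have "inj letter0" "inj letter1"
    by (auto simp: inj_def letter0_def letter1_def)
  then have "inj (letter0 ^^ k (Suc n))" "inj (letter1 ^^ m (Suc n))"
    by (simp_all add: inj_fn)
  with Suc show ?case
    unfolding word.simps by (intro inj_compose)
qed auto

text \<open>Cubing gains one power of 3: in \<open>a^3 - 1 = (a - 1) (a^2 + a + 1)\<close> the
  second factor is divisible by 3 when \<open>a\<close> is 1 modulo 3. The parity of
  \<open>p\<close> later decides the sign of the power of 2.\<close>

lemma cong_neg2_pow: "[(-2) ^ (p * 3 ^ s) = 1] (mod (3 ^ Suc s :: int))"
proof -
  have "[(-2) ^ (3 ^ s) = 1] (mod (3 ^ Suc s :: int))"
  proof (induction s)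
    case 0
    show ?case by (simp add: cong_iff_dvd_diff)
  next
    case (Suc s)
    define a :: int where "a = (-2) ^ (3 ^ s)"
    have a: "[a = 1] (mod 3 ^ Suc s)"
      using Suc by (simp add: a_def)
    then have "[a = 1] (mod 3)"
      by (rule cong_dvd_modulus) simp
    then have "[a ^ 2 + a + 1 = 1 ^ 2 + 1 + 1] (mod 3)"
      by (intro cong_add cong_pow) auto
    then have "3 dvd a ^ 2 + a + 1"
      by (simp add: cong_def dvd_eq_mod_eq_0)
    with a have "3 ^ Suc s * 3 dvd (a - 1) * (a ^ 2 + a + 1)"
      by (intro mult_dvd_mono) (simp_all add: cong_iff_dvd_diff)
    also have "(a - 1) * (a ^ 2 + a + 1) = a ^ 3 - 1"
      by (simp add: algebra_simps power2_eq_square power3_eq_cube)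
    also have "a ^ 3 = (-2) ^ (3 ^ Suc s)"
      by (simp only: a_def power_mult [symmetric] power_Suc mult.commute)
    finally show ?case
      by (simp only: cong_iff_dvd_diff power_Suc mult.commute)
  qed
  from cong_pow [OF this, of p] show ?thesis
    by (simp only: power_mult [symmetric] power_one mult.commute)
qed

lemma cong_two_pow_even:
  assumes "1 \<le> M"
  shows "[2 ^ (2 * l * 3 ^ (M - 1)) = 1] (mod (3 ^ M :: int))"
  using cong_neg2_pow [of "2 * l" "M - 1"] assms by simp

lemma dvd_two_pow_odd:
  assumes "1 \<le> M" and "odd p"
  shows "(3 ^ M :: int) dvd 2 ^ (p * 3 ^ (M - 1)) + 1"
proof -
  have "3 ^ M dvd (-2) ^ (p * 3 ^ (M - 1)) - (1 :: int)"
    using cong_neg2_pow [of p "M - 1"] assms by (simp add: cong_iff_dvd_diff)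
  also have "(-2) ^ (p * 3 ^ (M - 1)) - (1 :: int) = - (2 ^ (p * 3 ^ (M - 1)) + 1)"
    using assms by simp
  finally show ?thesis
    by (simp only: dvd_minus_iff)
qed

text \<open>The factor \<open>3 ^ m (Suc j)\<close> is used up by inverting this block; the surplus
  \<open>3 ^ s\<close> survives as a divisor for the blocks still to come.\<close>

lemma word_Suc_preimage:
  fixes N :: nat
  assumes word: "word j k m (of_nat N) = 1"
    and dvd: "(3 ^ (m (Suc j) + s) :: int) dvd 2 ^ k (Suc j) * int N + 1"
    and pos: "1 \<le> m (Suc j)"
  shows "\<exists>N'\<ge>1. word (Suc j) k m (of_nat N') = 1 \<and> (3 ^ s :: int) dvd int N' + 1"
proof -
  have "int (3 ^ (m (Suc j) + s)) dvd int (2 ^ k (Suc j) * N + 1)"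
    using dvd by (simp add: add.commute)
  then have "3 ^ (m (Suc j) + s) dvd 2 ^ k (Suc j) * N + 1"
    by (simp only: int_dvd_int_iff)
  then obtain c where c: "2 ^ k (Suc j) * N + 1 = 3 ^ (m (Suc j) + s) * c" ..
  \<comment> \<open>\<open>P\<close> is the preimage shifted by 1, solved from
    \<open>(3/2) ^ m (Suc j) * P - 1 = 2 ^ k (Suc j) * N\<close>.\<close>
  define P where "P = 2 ^ m (Suc j) * (3 ^ s * c)"
  have "c > 0"
    using c by (cases c) auto
  \<comment> \<open>Since \<open>m (Suc j)\<close> is positive, \<open>P\<close> is at least 2,
    which keeps the preimage \<open>P - 1\<close> out of 0.\<close>
  then have "(2 :: nat) ^ 1 * 1 \<le> P"
    unfolding P_def using pos by (intro mult_mono power_increasing) auto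
  then have P: "P \<ge> 2"
    by simp
  have "(of_nat (2 ^ k (Suc j) * N + 1) :: rat) = of_nat (3 ^ (m (Suc j) + s) * c)"
    by (simp only: c)
  then have N: "(2 :: rat) ^ k (Suc j) * of_nat N = 3 ^ m (Suc j) * (3 ^ s * of_nat c) - 1"
    by (simp add: power_add algebra_simps)
  have "(letter1 ^^ m (Suc j)) (of_nat (P - 1)) = (3 / 2) ^ m (Suc j) * of_nat P - 1"
    using P by (simp add: letter1_pow of_nat_diff)
  also have "\<dots> = 2 ^ k (Suc j) * of_nat N"
    by (simp add: N P_def power_divide)
  finally have "word (Suc j) k m (of_nat (P - 1)) = 1"
    using word by (simp add: letter0_pow)
  moreover have "int (P - 1) + 1 = 3 ^ s * (2 ^ m (Suc j) * int c)"
    using P by (simp add: of_nat_diff) (simp add: P_def)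
  then have "(3 ^ s :: int) dvd int (P - 1) + 1" ..
  ultimately show ?thesis
    using P by (intro exI [of _ "P - 1"]) auto
qed

lemma special_exponents_preimage:
  assumes n: "1 \<le> n" and l: "positive_upto n l" and m: "positive_upto n m"
    and k: "special_exponents n l m k"
  shows "\<exists>N\<ge>1. word n k m (of_nat N) = 1"
proof -
  define M where "M i = (\<Sum>j=i..n. m j)" for i
  have M: "M i = m i + M (Suc i)" if "i \<le> n" for i
    using that by (simp add: M_def sum.atLeast_Suc_atMost)
  have m_pos: "1 \<le> m i" if "i \<in> {1..n}" for i
    using m that by (auto simp: positive_upto_def)
  have M_pos: "1 \<le> M i" if "i \<in> {1..n}" for i
    using M [of i] m_pos [OF that] that by auto
  \<comment> \<open>At \<open>j = n\<close> the sum \<open>M (Suc n)\<close> is empty, so the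
    divisibility then holds trivially.\<close>
  have "j \<le> n \<longrightarrow> (\<exists>N\<ge>1. word j k m (of_nat N) = 1 \<and> (3 ^ M (Suc j) :: int) dvd int N + 1)"
    if "1 \<le> j" for j
    using that
  proof (induction j rule: nat_induct_at_least)
    case base
    have "odd (2 * l 1 - 1)"
      using l n by (simp add: positive_upto_def Suc_le_eq)
    then have "(3 ^ M 1 :: int) dvd 2 ^ k 1 + 1"
      using dvd_two_pow_odd [of "M 1"] M_pos [of 1] n k
      by (simp add: special_exponents_def M_def)
    then show ?case
      \<comment> \<open>The empty word is the identity, so the inversion starts at
        \<open>N = 1\<close>.\<close>
      using word_Suc_preimage [of 0 k m 1 "M 2"] M [of 1] n m_pos [of 1]
      by (simp add: numeral_2_eq_2)
  next
    case (Suc j)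
    show ?case
    proof
      assume j: "Suc j \<le> n"
      with Suc obtain N where N: "word j k m (of_nat N) = 1"
        and dvd: "(3 ^ M (Suc j) :: int) dvd int N + 1"
        by auto
      have "k (Suc j) = 2 * l (Suc j) * 3 ^ (M (Suc j) - 1)"
        using k j Suc.hyps by (simp add: special_exponents_def M_def)
      then have "[2 ^ k (Suc j) = 1] (mod (3 ^ M (Suc j) :: int))"
        using cong_two_pow_even M_pos [of "Suc j"] j by simp
      then have "[2 ^ k (Suc j) * int N + 1 = 1 * int N + 1] (mod 3 ^ M (Suc j))"
        by (intro cong_add cong_mult) auto
      with dvd have "(3 ^ M (Suc j) :: int) dvd 2 ^ k (Suc j) * int N + 1"
        by (simp add: cong_dvd_iff)
      then show "\<exists>N\<ge>1. word (Suc j) k m (of_nat N) = 1 \<and>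
          (3 ^ M (Suc (Suc j)) :: int) dvd int N + 1"
        using word_Suc_preimage [OF N] M [OF j] m_pos [of "Suc j"] j by simp
    qed
  qed
  with n show ?thesis
    by blast
qed

lemma special_exponents_positive:
  assumes "positive_upto n l" and "special_exponents n l m k"
  shows "positive_upto n k"
  unfolding positive_upto_def
proof
  fix i
  assume i: "i \<in> {1..n}"
  then have "1 \<le> l i"
    using assms by (simp add: positive_upto_def)
  with i assms show "1 \<le> k i"
    by (cases "i = 1") (auto simp: special_exponents_def Suc_le_eq)
qed

theorem theorem4p3:
  fixes n :: nat
  assumes "1 \<le> n"
  shows "(\<forall>m. positive_upto n m \<longrightarrow> (\<exists>k. positive_upto n k \<and> (\<exists>\<alpha>. \<alpha> \<in> solutions n k m))) \<and>
         special_set n \<subseteq> all_solutions n"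
proof (intro conjI allI impI subsetI)
  fix m
  assume m: "positive_upto n m"
  \<comment> \<open>Any positive \<open>l\<close> would do; 1 is the simplest choice.\<close>
  define l :: "nat \<Rightarrow> nat" where "l i = 1" for i
  define k where "k i = (if i = 1 then 2 * l i - 1 else 2 * l i) * 3 ^ ((\<Sum>j=i..n. m j) - 1)" for i
  have l: "positive_upto n l"
    by (simp add: positive_upto_def l_def)
  have k: "special_exponents n l m k"
    by (simp add: special_exponents_def k_def)
  show "\<exists>k. positive_upto n k \<and> (\<exists>\<alpha>. \<alpha> \<in> solutions n k m)"
    using special_exponents_preimage [OF assms l m k] special_exponents_positive [OF l k]
    by (fastforce simp: solutions_def)
next
  fix \<alpha>
  assume "\<alpha> \<in> special_set n"
  then obtain k l m where l: "positive_upto n l" and m: "positive_upto n m"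
    and k: "special_exponents n l m k" and \<alpha>: "word n k m \<alpha> = 1"
    by (auto simp: special_set_def)
  obtain N where N: "N \<ge> 1" "word n k m (of_nat N) = 1"
    using special_exponents_preimage [OF assms l m k] by blast
  have "\<alpha> = of_nat N"
    using inj_word [of n k m] \<alpha> N by (simp add: inj_def)
  then show "\<alpha> \<in> all_solutions n"
    using N m special_exponents_positive [OF l k] by (auto simp: all_solutions_def solutions_def)
qed

end
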